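(* Let $k\ge 2$ be an integer, let $q\in\mathbb{Q}^+_{T_k}\setminus\{0\}$, and let $r\ge 2$ be an integer that is a proper divisor of $k$. Then there exists a positive divisor $\delta$ of $k-1$ such that $$\left\{\overline{\bar r_k\!\left(\frac{q}{r^{j}}\right)}\;:\; j\in\mathbb{N}\right\}\subseteq \Gamma^{k-1}_{\delta},$$ where $\overline{x}$ denotes the residue class of the integer $x$ modulo $k-1$.
   Context: $\mathbb{N}=\{0,1,2,\dots\}$. Fix an integer base $k\ge 2$. A rational number $q$ is a terminating fractional to the base $k$ if there is $\rho\in\mathbb{N}$ with $k^{\rho}q\in\mathbb{Z}$; $\mathbb{Q}_{T_k}$ denotes the set of these and $\mathbb{Q}^+_{T_k}=\{q\in\mathbb{Q}_{T_k}: q\ge 0\}$. The minimum exponent of $q\in\mathbb{Q}_{T_k}$ to the base $k$ is $\rho_0=\min\{\rho\in\mathbb{N}: k^{\rho}q\in\mathbb{Z}\}$. For $n\in\mathbb{N}$ the digital sum $d_k(n)$ is the sum of the base-$k$ digits of $n$, and $d_k^{(N)}$ is the $N$-fold composition of $d_k$ with itself ($d_k^{(0)}$ is the identity). The additive persistence is $\mathcal{A}_k(n)=\min\{N\in\mathbb{N}: 0\le d_k^{(N)}(n)\le k-1\}$, and the digital root is $r_k(n)=d_k^{(\mathcal{A}_k(n))}(n)\in\{0,1,\dots,k-1\}$. For $q\in\mathbb{Q}^+_{T_k}$ with minimum exponent $\rho_0$, the terminating fractional digital root is $\bar r_k(q)=r_k(k^{\rho_0}q)$. (If $r$ divides $k$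 and $q\in\mathbb{Q}^+_{T_k}$, then $q/r^j\in\mathbb{Q}^+_{T_k}$ for every $j\in\mathbb{N}$.) For a positive integer $n$ and a positive divisor $\delta$ of $n$, $\Gamma^n_{\delta}=\{\overline{x}\in\mathbb{Z}_n:\gcd(x,n)=\delta\}$, where $\mathbb{Z}_n=\mathbb{Z}/n\mathbb{Z}$ and $\gcd(0,n)=n$. *)

theory Defs
  imports Complex_Main "HOL-Algebra.IntRing"
begin

definition terminating_fractionals :: "nat \<Rightarrow> rat set" where
  "terminating_fractionals k = {q. \<exists>\<rho>::nat. of_nat k ^ \<rho> * q \<in> \<int>}"

definition nonneg_terminating_fractionals :: "nat \<Rightarrow> rat set" where
  "nonneg_terminating_fractionals k = {q \<in> terminating_fractionals k. 0 \<le> q}"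

definition min_exponent :: "nat \<Rightarrow> rat \<Rightarrow> nat" where
  "min_exponent k q = (LEAST \<rho>. of_nat k ^ \<rho> * q \<in> \<int>)"

text \<open>The case \<open>k < 2\<close>, where there is no base-\<open>k\<close> expansion, is a dummy that makes
  the recursion terminate.\<close>

function digital_sum :: "nat \<Rightarrow> nat \<Rightarrow> nat" where
  "digital_sum k n = (if k < 2 \<or> n < k then n else n mod k + digital_sum k (n div k))"
  by auto
termination
  by (relation "measure snd") auto

declare digital_sum.simps [simp del]

definition additive_persistence :: "nat \<Rightarrow> nat \<Rightarrow> nat" where
  "additive_persistence k n = (LEAST N. (digital_sum k ^^ N) n \<le> k - 1)"

definition digital_root :: "nat \<Rightarrow> nat \<Rightarrow> nat" where
  "digital_root k n = (digital_sum k ^^ additive_persistence k n) n"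

text \<open>For \<open>q\<close> in \<^const>\<open>nonneg_terminating_fractionals\<close> the number under the floor is a
  nonnegative integer, so \<open>nat\<close> and the floor only convert its type.\<close>

definition fractional_digital_root :: "nat \<Rightarrow> rat \<Rightarrow> nat" where
  "fractional_digital_root k q = digital_root k (nat \<lfloor>of_nat k ^ min_exponent k q * q\<rfloor>)"

text \<open>\<^term>\<open>ZMod n x\<close> is the residue class of \<open>x\<close>, an element of the quotient ring
  \<^term>\<open>ZFact n\<close>. The gcd does not depend on the representative, see \<open>ZMod_in_Gamma_iff\<close>.\<close>

definition Gamma :: "nat \<Rightarrow> nat \<Rightarrow> int set set" where
  "Gamma n \<delta> = {c \<in> carrier (ZFact (int n)). \<exists>x. c = ZMod (int n) x \<and> gcd x (int n) = int \<delta>}"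

lemma ZMod_in_Gamma_iff: "ZMod (int n) x \<in> Gamma n \<delta> \<longleftrightarrow> gcd x (int n) = int \<delta>"
proof
  assume "ZMod (int n) x \<in> Gamma n \<delta>"
  then obtain y where y: "ZMod (int n) x = ZMod (int n) y" "gcd y (int n) = int \<delta>"
    unfolding Gamma_def by (elim CollectE conjE exE)
  have "x mod int n = y mod int n"
    using y(1) by (rule ZMod_imp_zmod)
  then have "gcd (int n) x = gcd (int n) y"
    by (metis gcd_red_int gcd.commute)
  then show "gcd x (int n) = int \<delta>"
    using y(2) by (simp only: gcd.commute)
next
  assume *: "gcd x (int n) = int \<delta>"
  have "ZMod (int n) x \<in> carrier (ZFact (int n))"
    unfolding ZFact_defs A_RCOSETS_defs ZMod_def a_r_coset_def by simp blast
  with * show "ZMod (int n) x \<in> Gamma n \<delta>"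
    unfolding Gamma_def by (intro CollectI conjI exI[of _ x] refl)
qed

end

theory Submission
  imports Defs "HOL-Number_Theory.Cong"
begin

text \<open>Since \<open>k \<equiv> 1 (mod k - 1)\<close>, a digital root to the base \<open>k\<close> is congruent modulo \<open>k - 1\<close> to the
  number it is taken of. Writing \<open>m\<^sub>j\<close> for the integer \<open>k\<^bsup>\<rho>\<^esup> q / r\<^sup>j\<close> with minimal \<open>\<rho>\<close>, the
  numbers \<open>m\<^sub>j\<close> and \<open>m\<^sub>0\<close> differ only by powers of \<open>k\<close> and \<open>r\<close>, both coprime to \<open>k - 1\<close>, so all
  \<open>m\<^sub>j\<close> have the same gcd with \<open>k - 1\<close>.\<close>

lemma digital_sum_cong: "[digital_sum k n = n] (mod (k - 1))"
proof (induction k n rule: digital_sum.induct)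
  case (1 k n)
  show ?case
  proof (cases "k < 2 \<or> n < k")
    case True
    then show ?thesis by (simp add: digital_sum.simps)
  next
    case False
    \<comment> \<open>Adding 1 to \<open>k - 1\<close> \<equiv> 0 gives \<open>k\<close> \<equiv> 1;
      the truncated subtraction is harmless since \<open>k\<close> \<ge> 2 in this case.\<close>
    have "[k - 1 + 1 = 0 + 1] (mod (k - 1))"
      by (intro cong_add) (simp_all add: cong_def)
    then have "[1 = k] (mod (k - 1))"
      using False by (simp add: cong_sym_eq)
    then have "[n mod k + 1 * digital_sum k (n div k) = n mod k + k * (n div k)] (mod (k - 1))"
      using "1.IH"[OF False] by (intro cong_add cong_mult cong_refl)
    then show ?thesis
      using False by (simp add: digital_sum.simps[of k n])
  qed
qed

lemma digital_root_cong: "[digital_root k n = n] (mod (k - 1))"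
proof -
  have "[(digital_sum k ^^ N) n = n] (mod (k - 1))" for N
    by (induction N) (simp_all add: cong_trans[OF digital_sum_cong] del: One_nat_def)
  then show ?thesis unfolding digital_root_def .
qed

lemma gcd_digital_root: "gcd (digital_root k n) (k - 1) = gcd n (k - 1)"
  by (rule cong_gcd_eq[OF digital_root_cong])

text \<open>Trades the floor and \<open>nat\<close> conversions for a natural number
  \<open>m\<close> that satisfies an exact equation over the rationals.\<close>

lemma fractional_digital_root_obtain:
  assumes "q \<in> nonneg_terminating_fractionals k"
  obtains m where "of_nat m = of_nat k ^ min_exponent k q * q"
    and "fractional_digital_root k q = digital_root k m"
proof -
  have "of_nat k ^ min_exponent k q * q \<in> \<int>"
    using assms unfolding min_exponent_def nonneg_terminating_fractionals_def
      terminating_fractionals_def by (auto intro: LeastI)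
  moreover have "0 \<le> of_nat k ^ min_exponent k q * q"
    using assms by (simp add: nonneg_terminating_fractionals_def)
  ultimately have "of_nat (nat \<lfloor>of_nat k ^ min_exponent k q * q\<rfloor>) = of_nat k ^ min_exponent k q * q"
    by (auto elim!: Ints_cases)
  then show thesis
    by (rule that) (simp add: fractional_digital_root_def)
qed

lemma nonneg_terminating_fractionals_divide_power:
  assumes "q \<in> nonneg_terminating_fractionals k" "r dvd k" "r \<noteq> 0"
  shows "q / of_nat r ^ j \<in> nonneg_terminating_fractionals k"
proof -
  obtain \<rho> where \<rho>: "of_nat k ^ \<rho> * q \<in> \<int>"
    using assms(1) by (auto simp: nonneg_terminating_fractionals_def terminating_fractionals_def)
  obtain s where s: "k = r * s" using assms(2) ..
  \<comment> \<open>The \<open>j\<close> extra factors \<open>k = r * s\<close> cancel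
    \<open>r ^ j\<close> and leave \<open>s ^ j\<close>.\<close>
  have "of_nat k ^ (\<rho> + j) * (q / of_nat r ^ j) = of_nat s ^ j * (of_nat k ^ \<rho> * q)"
    using assms(3) by (simp add: s power_add power_mult_distrib)
  also have "\<dots> \<in> \<int>" by (intro Ints_mult[OF _ \<rho>] Ints_power) simp
  finally have "q / of_nat r ^ j \<in> terminating_fractionals k"
    unfolding terminating_fractionals_def by blast
  then show ?thesis
    using assms(1) by (simp add: nonneg_terminating_fractionals_def)
qed

lemma gcd_fractional_digital_root_divide_power:
  assumes "q \<in> nonneg_terminating_fractionals k" "r dvd k" "k > 0"
  shows "gcd (fractional_digital_root k (q / of_nat r ^ j)) (k - 1)
    = gcd (fractional_digital_root k q) (k - 1)"
proof -
  have r: "r \<noteq> 0" using assms(2,3) by auto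
  obtain m where m: "of_nat m = of_nat k ^ min_exponent k q * q"
      "fractional_digital_root k q = digital_root k m"
    using fractional_digital_root_obtain[OF assms(1)] .
  define \<rho> where "\<rho> = min_exponent k (q / of_nat r ^ j)"
  obtain m' where m': "of_nat m' = of_nat k ^ \<rho> * (q / of_nat r ^ j)"
      "fractional_digital_root k (q / of_nat r ^ j) = digital_root k m'"
    using fractional_digital_root_obtain[OF
        nonneg_terminating_fractionals_divide_power[OF assms(1,2) r]] unfolding \<rho>_def .
  \<comment> \<open>Both sides equal \<open>k ^ \<rho> * k ^ min_exponent k q * q\<close>.
    Cross-multiplying avoids deciding which of the two exponents is larger.\<close>
  have "(of_nat (r ^ j * k ^ min_exponent k q * m') :: rat) = of_nat (k ^ \<rho> * m)"
    using r by (simp add: m(1) m'(1))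
  then have eq: "r ^ j * k ^ min_exponent k q * m' = k ^ \<rho> * m"
    using of_nat_eq_iff by blast
  have k: "coprime k (k - 1)" using assms(3) by (simp add: coprime_diff_one_right_nat del: One_nat_def)
  have "coprime r (k - 1)" using k assms(2) by (rule coprime_divisors[OF _ dvd_refl, rotated])
  \<comment> \<open>Factors coprime to \<open>k - 1\<close> can be inserted into or cancelled from
    the gcd: first pass from \<open>m'\<close> to the common product, then from it to
    \<open>m\<close>.\<close>
  with k have "gcd m' (k - 1) = gcd (r ^ j * k ^ min_exponent k q * m') (k - 1)"
    by (simp add: gcd_mult_left_left_cancel coprime_commute)
  also have "\<dots> = gcd m (k - 1)"
    using k by (simp add: eq gcd_mult_left_left_cancel coprime_commute)
  finally show ?thesis by (simp only: m(2) m'(2) gcd_digital_root)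
qed

theorem theorem3p1:
  fixes k r :: nat and q :: rat
  assumes "k \<ge> 2"
    and "q \<in> nonneg_terminating_fractionals k - {0}"
    and "r \<ge> 2" and "r dvd k" and "r \<noteq> k"
  shows "\<exists>\<delta>::nat. \<delta> > 0 \<and> \<delta> dvd k - 1 \<and>
    {ZMod (int (k - 1)) (int (fractional_digital_root k (q / of_nat r ^ j))) | j::nat. True}
      \<subseteq> Gamma (k - 1) \<delta>"
proof (intro exI conjI)
  \<comment> \<open>The gcd at \<open>j = 0\<close>; it is positive because \<open>k - 1\<close>
    is.\<close>
  let ?\<delta> = "gcd (fractional_digital_root k q) (k - 1)"
  show "?\<delta> > 0" using assms(1) by simp
  show "?\<delta> dvd k - 1" by simp
  have "gcd (fractional_digital_root k (q / of_nat r ^ j)) (k - 1) = ?\<delta>" for j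
    using assms by (intro gcd_fractional_digital_root_divide_power) auto
  then show "{ZMod (int (k - 1)) (int (fractional_digital_root k (q / of_nat r ^ j))) | j::nat. True}
      \<subseteq> Gamma (k - 1) ?\<delta>"
    by (auto simp only: ZMod_in_Gamma_iff gcd_int_int_eq)
qed

end
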